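(* Let $n\geq 2$ be an integer, let $D_0=(0,1,2,\dots,n-1)$, and let $D=(f_1,f_2,\dots,f_n)$ be an $n$-die with $\sum_{i=1}^n f_i=\frac{n(n-1)}{2}$. Then $D\precsim D_0$. Moreover, $D\sim D_0$ if and only if $f_i\leq n-1$ for all $i\in\{1,2,\dots,n\}$.
   Context: An $n$-die is a non-decreasing sequence $D=(f_1,f_2,\dots,f_n)$ of non-negative integers (repetitions allowed); the $f_i$ are its faces. For two $n$-dice $D=(f_1,\dots,f_n)$ and $D'=(f'_1,\dots,f'_n)$ put $\gamma(D,D')=\sum_{i=1}^n \mathrm{Card}\{j\in\{1,\dots,n\} \mid f_i>f'_j\}$ and $\Delta(D,D')=\gamma(D,D')-\gamma(D',D)$. One writes $D\precsim D'$ if $\Delta(D,D')\leq 0$ and $D\sim D'$ if $\Delta(D,D')=0$. *)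

theory Defs
  imports Main
begin

text \<open>A die is the list of its faces, so the face with index \<open>i\<close> in \<open>1, ..., n\<close>
  is \<open>D ! (i - 1)\<close>.\<close>

definition is_die :: "nat \<Rightarrow> nat list \<Rightarrow> bool" where
  "is_die n D \<longleftrightarrow> length D = n \<and> sorted D"

text \<open>The following notions are meant for two dice with the same number of faces.\<close>

definition gamma :: "nat list \<Rightarrow> nat list \<Rightarrow> nat" where
  "gamma D D' = (\<Sum>i<length D. card {j. j < length D' \<and> D ! i > D' ! j})"

definition Delta :: "nat list \<Rightarrow> nat list \<Rightarrow> int" where
  "Delta D D' = int (gamma D D') - int (gamma D' D)"

definition die_le :: "nat list \<Rightarrow> nat list \<Rightarrow> bool" (infix "\<precsim>" 50) where
  "D \<precsim> D' \<longleftrightarrow> Delta D D' \<le> 0"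

definition die_sim :: "nat list \<Rightarrow> nat list \<Rightarrow> bool" (infix "\<sim>" 50) where
  "D \<sim> D' \<longleftrightarrow> Delta D D' = 0"

end

theory Submission
  imports Defs
begin

text \<open>Against the standard die, a face \<open>f\<close> wins \<open>min n f\<close> times and loses \<open>n - 1 - f\<close> times
  (truncated at \<open>0\<close>). The difference is \<open>2 f - (n - 1)\<close> if \<open>f < n\<close>, and otherwise falls short of it
  by \<open>2 f + 1 - 2 n > 0\<close>. Since \<open>2 f - (n - 1)\<close> sums to \<open>0\<close> over the faces, \<open>\<Delta>\<close> is minus the total
  shortfall.\<close>

lemma gamma_standard_right: "gamma D [0..<n] = (\<Sum>i<length D. min n (D ! i))"
proof -
  have "{j. j < length [0..<n] \<and> D ! i > [0..<n] ! j} = {..<min n (D ! i)}" for i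
    by auto
  then show ?thesis
    by (simp add: gamma_def)
qed

text \<open>Double counting: the pairs \<open>(i, j)\<close> with \<open>D ! i < j\<close> are
  grouped by \<open>i\<close> instead of by \<open>j\<close>, so that each count is the size of an
  interval.\<close>

lemma gamma_standard_left: "gamma [0..<n] D = (\<Sum>i<length D. n - 1 - D ! i)"
proof -
  have "gamma [0..<n] D = (\<Sum>j<n. card {i \<in> {..<length D}. D ! i < j})"
    by (simp add: gamma_def)
  also have "\<dots> = (\<Sum>i<length D. card {j \<in> {..<n}. D ! i < j})"
    by (rule sum_multicount_gen) auto
  also have "\<dots> = (\<Sum>i<length D. n - 1 - D ! i)"
  proof (rule sum.cong [OF refl])
    fix i
    have "{j \<in> {..<n}. D ! i < j} = {D ! i<..<n}"
      by auto
    then show "card {j \<in> {..<n}. D ! i < j} = n - 1 - D ! i"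
      by simp
  qed
  finally show ?thesis .
qed

lemma Delta_standard:
  "Delta D [0..<n] =
    2 * int (sum_list D) - int (length D) * (int n - 1) - int (\<Sum>i<length D. 2 * D ! i + 1 - 2 * n)"
proof -
  \<comment> \<open>Truncation in \<open>2 * f + 1 - 2 * n\<close> lets one formula cover both
    \<open>f < n\<close> and \<open>f \<ge> n\<close>.\<close>
  have "int (min n f) - int (n - 1 - f) = 2 * int f - (int n - 1) - int (2 * f + 1 - 2 * n)"
    for f
    by (cases "f < n") (auto simp: of_nat_diff)
  then have "Delta D [0..<n] =
      (\<Sum>i<length D. 2 * int (D ! i) - (int n - 1) - int (2 * D ! i + 1 - 2 * n))"
    by (simp add: Delta_def gamma_standard_right gamma_standard_left flip: sum_subtractf)
  then show ?thesis
    by (simp add: sum_subtractf sum_list_sum_nth atLeast0LessThan flip: sum_distrib_left)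
qed

theorem proposition3p1:
  fixes n :: nat and D D\<^sub>0 :: "nat list"
  assumes "n \<ge> 2"
    and "D\<^sub>0 = [0..<n]"
    and "is_die n D"
    and "sum_list D = n * (n - 1) div 2"
  shows "D \<precsim> D\<^sub>0 \<and> (D \<sim> D\<^sub>0 \<longleftrightarrow> (\<forall>i<n. D ! i \<le> n - 1))"
proof -
  have len: "length D = n"
    using assms(3) by (simp add: is_die_def)
  \<comment> \<open>Evenness makes the \<open>div 2\<close> in the hypothesis exact.\<close>
  have "even (n * (n - 1))"
    by (cases n) simp_all
  then have "int (2 * sum_list D) = int (n * (n - 1))"
    using assms(4) by (metis dvd_mult_div_cancel)
  then have "2 * int (sum_list D) = int n * (int n - 1)"
    using assms(1) by (simp add: of_nat_diff)
  then have Delta: "Delta D D\<^sub>0 = - int (\<Sum>i<n. 2 * D ! i + 1 - 2 * n)"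
    by (simp add: assms(2) Delta_standard len)
  have "D \<sim> D\<^sub>0 \<longleftrightarrow> (\<forall>i<n. 2 * D ! i + 1 - 2 * n = 0)"
    unfolding die_sim_def Delta neg_equal_0_iff_equal of_nat_eq_0_iff by (simp add: Ball_def)
  \<comment> \<open>By parity, \<open>2 * f + 1 \<le> 2 * n\<close> amounts to \<open>f < n\<close>;
    as \<open>n > 0\<close>, \<open>n - 1\<close> is not truncated.\<close>
  also have "\<dots> \<longleftrightarrow> (\<forall>i<n. D ! i \<le> n - 1)"
    using assms(1) by (intro all_cong) linarith
  finally show ?thesis
    unfolding die_le_def Delta by (simp add: sum_nonneg)
qed

end
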